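(* Let $\mathcal{A}$ and $\mathcal{S}$ be finite posets with connected Hasse diagrams, and let $\mathcal{S}$ be a poset of Class W. Then each of the following conditions is sufficient for monotonicity equivalence to hold for $(\mathcal{A},\mathcal{S})$: (i) $\mathcal{A}$ has a minimum element $a_*$ and a maximum element $a^*$; (ii) $\mathcal{A}$ has a minimum element $a_*$ and $\mathcal{S}$ is in Class $\mathrm{W}_\star$; (iii) $\mathcal{A}$ has a maximum element $a^*$ and $\mathcal{S}$ is in Class $\mathrm{W}^\star$; (iv) $\mathcal{S}$ is an up-down poset.
   Context: The Hasse diagram of a finite poset is regarded as an undirected graph (edges are the covering pairs). Classes of posets. A Y-poset is the four-element poset $\{w,z,x,y\}$ with $z$ covered by $w$ and $z$ covering $x$ and $y$ ($x,y$ incomparable), or its dual. A $\mathrm{W}^\star$-poset is the four-element poset $\{w,x,y,z\}$ whose only strict relations are $w<x$, $w<y$, $w<z$; a $\mathrm{W}_\star$-poset is its dual ($x,y,z<w$). A poset $\mathcal{S}$ is of Class W if its Hasse diagram is a tree and it has no induced Y-poset. A poset of Class W is an up-down poset if it has no induced $\mathrm{W}^\star$-poset and no induced $\mathrm{W}_\star$-poset. A poset of Class W that is not an up-down poset is in Class $\mathrm{W}_\star$ if it contains only $\mathrm{W}_\star$-posets (no induced $\mathrm{W}^\star$-poset), and in Class $\mathrm{W}^\star$ if it contains only $\mathrm{W}^\star$-posets (no induced $\mathrm{W}_\star$-poset). Monotonicity. For probability measures $P,P'$ on $\mathcal{S}$, $P\preceq P'$ means $P(U)\le P'(U)$ for every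 up-set $U$ of $\mathcal{S}$. A system $(P_\gamma:\gamma\in\mathcal{A})$ of probability measures on $\mathcal{S}$ is stochastically monotone if $P_\alpha\preceq P_\beta$ whenever $\alpha<\beta$ in $\mathcal{A}$. It is realizably monotone if there are $\mathcal{S}$-valued random variables $(X_\gamma:\gamma\in\mathcal{A})$ on a common probability space such that $X_\gamma$ has distribution $P_\gamma$ for each $\gamma$ and $X_\alpha\le X_\beta$ in $\mathcal{S}$ whenever $\alpha<\beta$ in $\mathcal{A}$. Monotonicity equivalence holds for $(\mathcal{A},\mathcal{S})$ if, for systems of probability measures on $\mathcal{S}$ indexed by $\mathcal{A}$, stochastic monotonicity and realizable monotonicity are equivalent. *)

theory Defs
  imports "HOL-Probability.Probability" "Graph_Theory.Graph_Theory"
begin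

text \<open>Posets are types of class \<^class>\<open>order\<close>; an induced subposet is a subset \<open>T\<close> of
  such a type with the restricted order.\<close>

definition covered_by :: "'a::order set \<Rightarrow> 'a \<Rightarrow> 'a \<Rightarrow> bool" where
  "covered_by T x y \<longleftrightarrow> x \<in> T \<and> y \<in> T \<and> x < y \<and> \<not> (\<exists>z\<in>T. x < z \<and> z < y)"

text \<open>An undirected graph is a symmetric digraph, as usual in \<open>Graph_Theory\<close>.\<close>

definition hasse_diagram :: "'a::order set \<Rightarrow> ('a, 'a \<times> 'a) pre_digraph" where
  "hasse_diagram T =
     with_proj \<lparr>pverts = T, parcs = {(x, y). covered_by T x y \<or> covered_by T y x}\<rparr>"

text \<open>Not the topological notion of the same name.\<close>

abbreviation graph_connected :: "('a, 'b) pre_digraph \<Rightarrow> bool" where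
  "graph_connected \<equiv> Digraph_Component.connected"

text \<open>The library's \<^const>\<open>tree\<close> forbids all directed cycles, and in a symmetric digraph
  every edge gives a directed cycle of length 2. In a symmetric digraph without loops and
  parallel arcs, the cycles of the underlying undirected graph are the directed cycles of
  length at least 3.\<close>

definition undirected_tree :: "('a, 'b) pre_digraph \<Rightarrow> bool" where
  "undirected_tree G \<longleftrightarrow>
     graph_connected G \<and> \<not> (\<exists>p. pre_digraph.cycle G p \<and> length p \<ge> 3)"

definition Y_poset :: "'a::order set \<Rightarrow> bool" where
  "Y_poset T \<longleftrightarrow> (\<exists>w z x y. T = {w, z, x, y} \<and> card T = 4 \<and> \<not> x \<le> y \<and> \<not> y \<le> x \<and>
     (covered_by T z w \<and> covered_by T x z \<and> covered_by T y z \<or>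
      covered_by T w z \<and> covered_by T z x \<and> covered_by T z y))"

definition W_upper_star_poset :: "'a::order set \<Rightarrow> bool" where
  "W_upper_star_poset T \<longleftrightarrow> (\<exists>w x y z. T = {w, x, y, z} \<and> card T = 4 \<and>
     (\<forall>u\<in>T. \<forall>v\<in>T. u < v \<longleftrightarrow> u = w \<and> v \<in> {x, y, z}))"

definition W_lower_star_poset :: "'a::order set \<Rightarrow> bool" where
  "W_lower_star_poset T \<longleftrightarrow> (\<exists>w x y z. T = {w, x, y, z} \<and> card T = 4 \<and>
     (\<forall>u\<in>T. \<forall>v\<in>T. u < v \<longleftrightarrow> u \<in> {x, y, z} \<and> v = w))"

definition class_W :: "'s::order itself \<Rightarrow> bool" where
  "class_W _ \<longleftrightarrow>
     undirected_tree (hasse_diagram (UNIV :: 's set)) \<and> \<not> (\<exists>T :: 's set. Y_poset T)"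

definition up_down_poset :: "'s::order itself \<Rightarrow> bool" where
  "up_down_poset _ \<longleftrightarrow> class_W TYPE('s) \<and>
     \<not> (\<exists>T :: 's set. W_upper_star_poset T) \<and> \<not> (\<exists>T :: 's set. W_lower_star_poset T)"

definition class_W_lower_star :: "'s::order itself \<Rightarrow> bool" where
  "class_W_lower_star _ \<longleftrightarrow> class_W TYPE('s) \<and> \<not> up_down_poset TYPE('s) \<and>
     \<not> (\<exists>T :: 's set. W_upper_star_poset T)"

definition class_W_upper_star :: "'s::order itself \<Rightarrow> bool" where
  "class_W_upper_star _ \<longleftrightarrow> class_W TYPE('s) \<and> \<not> up_down_poset TYPE('s) \<and>
     \<not> (\<exists>T :: 's set. W_lower_star_poset T)"

definition up_set :: "'s::order set \<Rightarrow> bool" where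
  "up_set U \<longleftrightarrow> (\<forall>x\<in>U. \<forall>y. x \<le> y \<longrightarrow> y \<in> U)"

text \<open>On a finite \<open>'s\<close> the probability measures are exactly the \<^typ>\<open>'s pmf\<close>.\<close>

definition stochastically_le :: "'s::order pmf \<Rightarrow> 's pmf \<Rightarrow> bool" where
  "stochastically_le P P' \<longleftrightarrow> (\<forall>U. up_set U \<longrightarrow> measure_pmf.prob P U \<le> measure_pmf.prob P' U)"

definition stochastically_monotone :: "('a::order \<Rightarrow> 's::order pmf) \<Rightarrow> bool" where
  "stochastically_monotone P \<longleftrightarrow> (\<forall>\<alpha> \<beta>. \<alpha> < \<beta> \<longrightarrow> stochastically_le (P \<alpha>) (P \<beta>))"

definition monotone_realization ::
  "('a::order \<Rightarrow> 's::order pmf) \<Rightarrow> 'w measure \<Rightarrow> ('a \<Rightarrow> 'w \<Rightarrow> 's) \<Rightarrow> bool" where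
  "monotone_realization P M X \<longleftrightarrow> prob_space M \<and>
     (\<forall>\<gamma>. X \<gamma> \<in> M \<rightarrow>\<^sub>M count_space UNIV \<and>
          distr M (count_space UNIV) (X \<gamma>) = measure_pmf (P \<gamma>)) \<and>
     (\<forall>\<alpha> \<beta>. \<alpha> < \<beta> \<longrightarrow> (\<forall>\<omega>\<in>space M. X \<alpha> \<omega> \<le> X \<beta> \<omega>))"

text \<open>HOL cannot quantify over the type of the sample space inside a formula. Fixing it to
  \<^typ>\<open>'a \<Rightarrow> 's\<close> loses no generality: see \<open>realizably_monotoneI\<close> below.\<close>

definition realizably_monotone :: "('a::order \<Rightarrow> 's::order pmf) \<Rightarrow> bool" where
  "realizably_monotone P \<longleftrightarrow>
     (\<exists>(M :: ('a \<Rightarrow> 's) measure) X. monotone_realization P M X)"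

definition monotonicity_equivalence :: "'a::order itself \<Rightarrow> 's::order itself \<Rightarrow> bool" where
  "monotonicity_equivalence _ _ \<longleftrightarrow>
     (\<forall>P :: 'a \<Rightarrow> 's pmf. stochastically_monotone P \<longleftrightarrow> realizably_monotone P)"

lemma realizably_monotoneI:
  fixes P :: "'a::{finite, order} \<Rightarrow> 's::{finite, order} pmf" and M :: "'w measure"
  assumes "monotone_realization P M X"
  shows "realizably_monotone P"
proof -
  define F where "F = {f :: 'a \<Rightarrow> 's. \<forall>\<alpha> \<beta>. \<alpha> < \<beta> \<longrightarrow> f \<alpha> \<le> f \<beta>}"
  define Z where "Z = (\<lambda>\<omega> \<gamma>. X \<gamma> \<omega>)"
  interpret prob_space M
    using assms by (simp add: monotone_realization_def)
  have X: "X \<gamma> \<in> M \<rightarrow>\<^sub>M count_space UNIV"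
    and distr: "distr M (count_space UNIV) (X \<gamma>) = measure_pmf (P \<gamma>)" for \<gamma>
    using assms by (auto simp: monotone_realization_def)
  have ZF: "Z \<in> space M \<rightarrow> F"
    using assms by (auto simp: monotone_realization_def Z_def F_def)
  have "Z -` {f} \<inter> space M \<in> sets M" for f
  proof -
    have "Z -` {f} \<inter> space M = {\<omega> \<in> space M. \<forall>\<gamma>\<in>UNIV. X \<gamma> \<omega> \<in> {f \<gamma>}}"
      by (auto simp: Z_def)
    also have "\<dots> \<in> sets M"
      by (intro sets.sets_Collect_finite_All measurable_sets_Collect[OF X]) auto
    finally show ?thesis .
  qed
  then have Z: "Z \<in> M \<rightarrow>\<^sub>M count_space F"
    using ZF by (subst measurable_count_space_eq2) auto
  have "monotone_realization P (distr M (count_space F) Z) (\<lambda>\<gamma> f. f \<gamma>)"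
    unfolding monotone_realization_def
  proof (intro conjI allI impI ballI)
    show "prob_space (distr M (count_space F) Z)"
      by (rule prob_space_distr[OF Z])
    show "distr (distr M (count_space F) Z) (count_space UNIV) (\<lambda>f. f \<gamma>) = measure_pmf (P \<gamma>)"
      for \<gamma>
      using distr[of \<gamma>] by (subst distr_distr[OF _ Z]) (auto simp: comp_def Z_def)
  qed (auto simp: F_def)
  then show ?thesis
    unfolding realizably_monotone_def by blast
qed

end

theory Submission
  imports Defs
begin

text \<open>Cutting an edge \<open>v - w\<close> of the Hasse tree splits \<open>\<S>\<close> into an up-set and a down-set, so each
  event ``\<open>X\<^sub>\<alpha>\<close> lies on the \<open>w\<close>-side'' has a prescribed probability that is monotone in \<open>\<alpha>\<close>. Realize
  it as an arc of that length on the circle \<open>[0, 1)\<close>, starting or ending at an anchor that does not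
  depend on \<open>\<alpha>\<close>. A point of the circle then orients every edge, and \<open>X\<^sub>\<alpha>\<close> is the sink of this
  orientation. The sink exists and has law \<open>P\<^sub>\<alpha>\<close> as soon as the arcs leaving each vertex are
  disjoint, and it is monotone because increasing \<open>\<alpha>\<close> flips edges only upwards.

  It remains to choose the anchors, moving through the tree vertex by vertex. At a vertex of degree
  at most 2 the two arcs lie on opposite sides of a common anchor. Without Y-posets, a vertex of
  degree at least 3 is maximal or minimal in \<open>\<S>\<close>, and its arcs are longest at the minimum or
  maximum of \<open>\<A>\<close>, respectively; laying out the longest arcs one after the other makes all of them
  disjoint.\<close>

section \<open>Finite trees\<close>

text \<open>Acyclicity is phrased as: deleting a vertex separates its neighbours from each other. In
  this form it makes the branches at a vertex disjoint without any reference to cycles.\<close>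

locale finite_tree =
  fixes adj :: "'v::finite \<Rightarrow> 'v \<Rightarrow> bool"
  assumes adj_sym: "adj v w \<Longrightarrow> adj w v"
    and adj_irrefl: "\<not> adj v v"
    and adj_connected: "adj\<^sup>*\<^sup>* v w"
    and adj_acyclic: "\<lbrakk>adj v w; adj v w'; (\<lambda>a b. adj a b \<and> a \<noteq> v \<and> b \<noteq> v)\<^sup>*\<^sup>* w w'\<rbrakk> \<Longrightarrow> w = w'"
begin

text \<open>For adjacent \<open>v\<close> and \<open>w\<close> this is the component of
  \<open>w\<close> after deletion of \<open>v\<close>, that is, the \<open>w\<close>-side of the
  edge.\<close>

definition branch :: "'v \<Rightarrow> 'v \<Rightarrow> 'v set" where
  "branch v w = {x. (\<lambda>a b. adj a b \<and> a \<noteq> v \<and> b \<noteq> v)\<^sup>*\<^sup>* w x}"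

lemma root_in_branch: "w \<in> branch v w"
  by (simp add: branch_def)

lemma branch_step:
  "\<lbrakk>x \<in> branch v w; adj x y; x \<noteq> v; y \<noteq> v\<rbrakk> \<Longrightarrow> y \<in> branch v w"
  unfolding branch_def by (auto intro: rtranclp.rtrancl_into_rtrancl)

lemma notin_branch:
  assumes "adj v w" shows "v \<notin> branch v w"
proof
  assume "v \<in> branch v w"
  then have "(\<lambda>a b. adj a b \<and> a \<noteq> v \<and> b \<noteq> v)\<^sup>*\<^sup>* w v"
    by (simp add: branch_def)
  then show False
    using assms adj_irrefl by cases auto
qed

lemma branch_unique:
  assumes "adj v w" "adj v w'" "x \<in> branch v w" "x \<in> branch v w'"
  shows "w = w'"
proof -
  let ?R = "\<lambda>a b. adj a b \<and> a \<noteq> v \<and> b \<noteq> v"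
  have "symp ?R"
    using adj_sym by (auto simp: symp_def)
  then have "?R\<^sup>*\<^sup>* x w'"
    using assms(4) by (auto simp: branch_def dest: symp_rtranclp[THEN sympD])
  then have "?R\<^sup>*\<^sup>* w w'"
    using assms(3) by (auto simp: branch_def)
  then show ?thesis
    using adj_acyclic assms by blast
qed

lemma branch_cover:
  assumes "x \<noteq> v" shows "\<exists>w. adj v w \<and> x \<in> branch v w"
proof -
  have "x = v \<or> (\<exists>w. adj v w \<and> x \<in> branch v w)"
    using adj_connected[of v x]
  proof induction
    case (step y z)
    show ?case
    proof (cases "z = v \<or> y = v")
      case True
      then show ?thesis
        using step root_in_branch by blast
    next
      case False
      then show ?thesis
        using step branch_step by blast
    qed
  qed simp
  then show ?thesis
    using assms by blast
qed

text \<open>A walk from \<open>v\<close> that avoids \<open>w\<close> cannot enter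
  \<open>branch v w\<close>, since the only way in from \<open>v\<close> is through
  \<open>w\<close>. Conversely, a vertex outside \<open>branch v w\<close> is \<open>v\<close> or
  lies in another branch at \<open>v\<close>, and is thus reached from \<open>v\<close> without
  meeting \<open>w\<close>.\<close>

lemma branch_compl:
  assumes "adj v w" shows "branch w v = - branch v w"
proof
  show "branch w v \<subseteq> - branch v w"
  proof
    fix x assume "x \<in> branch w v"
    then have "(\<lambda>a b. adj a b \<and> a \<noteq> w \<and> b \<noteq> w)\<^sup>*\<^sup>* v x"
      by (simp add: branch_def)
    then have "x \<notin> branch v w"
    proof induction
      case base
      then show ?case
        using assms notin_branch by blast
    next
      case (step y z)
      show ?case
      proof
        assume z: "z \<in> branch v w"
        then have "z \<noteq> v"
          using assms notin_branch by blast
        show False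
        proof (cases "y = v")
          case True
          then have "z = w"
            using branch_unique[of v z w z] step z assms root_in_branch by blast
          then show False
            using step by blast
        next
          case False
          then have "y \<in> branch v w"
            using branch_step[OF z] step adj_sym \<open>z \<noteq> v\<close> by blast
          then show False
            using step by blast
        qed
      qed
    qed
    then show "x \<in> - branch v w"
      by simp
  qed
  show "- branch v w \<subseteq> branch w v"
  proof
    fix x assume x: "x \<in> - branch v w"
    show "x \<in> branch w v"
    proof (cases "x = v")
      case True
      then show ?thesis
        using root_in_branch by simp
    next
      case False
      then obtain w' where w': "adj v w'" "x \<in> branch v w'"
        using branch_cover by blast
      then have "w' \<noteq> w"
        using x by blast
      have "(\<lambda>a b. adj a b \<and> a \<noteq> v \<and> b \<noteq> v)\<^sup>*\<^sup>* w' x"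
        using w' by (simp add: branch_def)
      \<comment> \<open>The second conjunct is carried along to know that the walk never meets
        \<open>w\<close>.\<close>
      then have "x \<in> branch w v \<and> x \<in> branch v w'"
      proof induction
        case base
        have "v \<noteq> w"
          using assms adj_irrefl by blast
        then show ?case
          using branch_step[OF root_in_branch, of v w' w] w' \<open>w' \<noteq> w\<close> root_in_branch by blast
      next
        case (step y z)
        then have z: "z \<in> branch v w'"
          using branch_step by blast
        have "w \<notin> branch v w'"
          using branch_unique assms w' \<open>w' \<noteq> w\<close> root_in_branch by blast
        then have "z \<noteq> w" "y \<noteq> w"
          using z step by blast+
        then show ?case
          using step z branch_step[of y w v z] by blast
      qed
      then show ?thesis
        by simp
    qed
  qed
qed

text \<open>One edge further out, \<open>w\<close> is lost and nothing is gained. The size of the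
  branch is therefore the measure for inductions along walks that never turn back.\<close>

lemma branch_psubset:
  assumes "adj v w" "adj w w'" "w' \<noteq> v"
  shows "branch w w' \<subset> branch v w"
proof -
  have "branch w w' \<inter> branch w v = {}"
    using assms branch_unique adj_sym by blast
  then have "branch w w' \<subseteq> branch v w"
    using branch_compl[OF assms(1)] by auto
  moreover have "w \<in> branch v w - branch w w'"
    using root_in_branch notin_branch assms by blast
  ultimately show ?thesis
    by blast
qed

lemma branch_card_less:
  "\<lbrakk>adj v w; adj w w'; w' \<noteq> v\<rbrakk> \<Longrightarrow> card (branch w w') < card (branch v w)"
  by (rule psubset_card_mono[OF finite branch_psubset])

section \<open>Orientations of a tree and their sinks\<close>

text \<open>\<open>out v w\<close> stands for the edge pointing from \<open>v\<close> to
  \<open>w\<close>. The second clause, at most one outgoing edge per vertex, is what disjoint arcs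
  will provide.\<close>

definition orientation :: "('v \<Rightarrow> 'v \<Rightarrow> bool) \<Rightarrow> bool" where
  "orientation out \<longleftrightarrow>
     (\<forall>v w. adj v w \<longrightarrow> (out v w \<longleftrightarrow> \<not> out w v)) \<and>
     (\<forall>v w w'. adj v w \<and> adj v w' \<and> out v w \<and> out v w' \<longrightarrow> w = w')"

definition sink :: "('v \<Rightarrow> 'v \<Rightarrow> bool) \<Rightarrow> 'v \<Rightarrow> bool" where
  "sink out x \<longleftrightarrow> (\<forall>w. adj x w \<longrightarrow> \<not> out x w)"

text \<open>Without a sink one could follow outgoing edges forever. Such a walk never turns back,
  since an edge points only one way, so the branches ahead of it shrink strictly.\<close>

lemma sink_exists:
  assumes "orientation out" shows "\<exists>x. sink out x"
proof (rule ccontr)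
  assume "\<nexists>x. sink out x"
  then have ex: "\<exists>w. adj x w \<and> out x w" for x
    by (auto simp: sink_def)
  have False if "adj v w" "out v w" for v w
    using that
  proof (induction "card (branch v w)" arbitrary: v w rule: less_induct)
    case less
    obtain w' where w': "adj w w'" "out w w'"
      using ex by blast
    then have "w' \<noteq> v"
      using less.prems assms by (auto simp: orientation_def)
    then show ?case
      using less w' branch_card_less by blast
  qed
  then show False
    using ex by blast
qed

text \<open>All edges point towards the sink. If the edge from \<open>v\<close> to \<open>w\<close>
  pointed away from \<open>x\<close>, then the edge at \<open>v\<close> on the side of
  \<open>x\<close> could not be outgoing as well, so it would also point away from \<open>x\<close>,
  and this would continue until \<open>x\<close> itself had an outgoing edge.\<close>

lemma out_sink_iff:
  assumes "orientation out" "sink out x" "adj v w"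
  shows "out v w \<longleftrightarrow> x \<in> branch v w"
proof -
  have imp: "x \<in> branch v w" if "adj v w" "out v w" for v w
  proof (rule ccontr)
    assume "x \<notin> branch v w"
    then show False
      using that
    \<comment> \<open>The measure is the size of the side that contains \<open>x\<close>; it drops
      when passing to the wrongly directed edge from \<open>v'\<close> to \<open>v\<close>.\<close>
    proof (induction "card (branch w v)" arbitrary: v w rule: less_induct)
      case less
      then have "x \<noteq> v"
        using assms by (auto simp: sink_def)
      then obtain v' where v': "adj v v'" "x \<in> branch v v'"
        using branch_cover by blast
      with less have "v' \<noteq> w"
        by blast
      then have "out v' v"
        using less.prems(2,3) v'(1) assms(1) \<open>v' \<noteq> w\<close> unfolding orientation_def by metis
      moreover have "x \<notin> branch v' v"
        using branch_compl v' by blast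
      moreover have "card (branch v v') < card (branch w v)"
        using branch_card_less adj_sym less.prems v' \<open>v' \<noteq> w\<close> by blast
      ultimately show ?case
        using less.hyps v' adj_sym by blast
    qed
  qed
  have "out w v \<longleftrightarrow> \<not> out v w"
    using assms by (auto simp: orientation_def)
  then show ?thesis
    using imp[OF assms(3)] imp[OF adj_sym[OF assms(3)]] branch_compl[OF assms(3)] by blast
qed

lemma sink_unique:
  assumes "orientation out" "sink out x" "sink out y"
  shows "x = y"
proof (rule ccontr)
  assume "x \<noteq> y"
  then obtain w where "adj x w" "y \<in> branch x w"
    using branch_cover[of y x] by blast
  then show False
    using out_sink_iff[OF assms(1,3)] assms(2) by (auto simp: sink_def)
qed

text \<open>A labelling is built by adding one vertex at a time to a connected set \<open>T\<close>: the new
  vertex \<open>u\<close> has a single neighbour in \<open>T\<close>, so relabelling its other edges does not affect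
  the vertices of \<open>T\<close>.\<close>

lemma labelling_exists:
  fixes good :: "'v \<Rightarrow> ('v \<Rightarrow> 'l) \<Rightarrow> bool" and flip :: "'l \<Rightarrow> 'l"
  assumes init: "\<And>v w. adj v w \<Longrightarrow> L0 w v = flip (L0 v w)"
    and flip: "\<And>l. flip (flip l) = l"
    and cong: "\<And>v K K'. \<lbrakk>\<And>w. adj v w \<Longrightarrow> K w = K' w\<rbrakk> \<Longrightarrow> good v K \<Longrightarrow> good v K'"
    and star: "\<And>v w l. adj v w \<Longrightarrow> \<exists>K. K w = l \<and> good v K"
    and single: "\<And>v K. \<lbrakk>\<And>w. \<not> adj v w\<rbrakk> \<Longrightarrow> good v K"
  shows "\<exists>L. (\<forall>v w. adj v w \<longrightarrow> L w v = flip (L v w)) \<and> (\<forall>v. good v (L v))"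
proof -
  define sym where "sym L \<longleftrightarrow> (\<forall>v w. adj v w \<longrightarrow> L w v = flip (L v w))" for L :: "'v \<Rightarrow> 'v \<Rightarrow> 'l"
  have extend: "\<exists>L'. sym L' \<and> (\<forall>v\<in>insert u T. good v (L' v))"
    if L: "sym L" "\<forall>v\<in>T. good v (L v)" and u: "u \<notin> T" "adj u t"
      and uniq: "\<And>w. adj u w \<Longrightarrow> w \<in> T \<Longrightarrow> w = t" for L T u t
  proof -
    obtain K where K: "K t = L u t" "good u K"
      using star[OF u(2)] by blast
    define L' where "L' v w = (if v = u then K w else if w = u then flip (K v) else L v w)" for v w
    have "L' w v = flip (L' v w)" if "adj v w" for v w
      using that L(1) flip adj_irrefl by (auto simp: L'_def sym_def)
    moreover have "good v (L' v)" if "v \<in> insert u T" for v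
    proof (cases "v = u")
      case True
      then show ?thesis
        using K(2) cong[of u K "L' u"] by (simp add: L'_def)
    next
      case False
      then have "v \<in> T"
        using that by simp
      have "L v w = L' v w" if "adj v w" for w
      proof (cases "w = u")
        case True
        then have "v = t"
          using uniq \<open>v \<in> T\<close> that adj_sym by blast
        then have "L v w = flip (L u t)"
          using L(1) u(2) True by (auto simp: sym_def)
        then show ?thesis
          using False True K(1) \<open>v = t\<close> by (simp add: L'_def)
      qed (simp add: L'_def False)
      then show ?thesis
        using cong L(2) \<open>v \<in> T\<close> by blast
    qed
    ultimately show ?thesis
      by (auto simp: sym_def)
  qed
  \<comment> \<open>That \<open>T\<close> lies in a single branch at each outside vertex is the form
    of connectedness used: it leaves such a vertex at most one neighbour in \<open>T\<close>, and it
    survives adding a neighbour of \<open>T\<close>.\<close>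
  have "\<exists>T L. card T = Suc n \<and> (\<forall>u. u \<notin> T \<longrightarrow> (\<exists>w. adj u w \<and> T \<subseteq> branch u w))
      \<and> sym L \<and> (\<forall>v\<in>T. good v (L v))" if "Suc n \<le> card (UNIV :: 'v set)" for n
    using that
  proof (induction n)
    case 0
    obtain r :: 'v where True
      by simp
    have "\<exists>L. sym L \<and> good r (L r)"
    proof (cases "\<exists>t. adj r t")
      case True
      then obtain t where t: "adj r t"
        by blast
      show ?thesis
        \<comment> \<open>With an empty \<open>T\<close> the uniqueness condition is vacuous, so any
          neighbour \<open>t\<close> of \<open>r\<close> will do.\<close>
        using extend[of L0 "{}" r t] t init by (auto simp: sym_def)
    next
      case False
      then have "good r (L0 r)"
        using single by blast
      then show ?thesis
        using init sym_def by blast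
    qed
    moreover have "\<exists>w. adj u w \<and> {r} \<subseteq> branch u w" if "u \<notin> {r}" for u
      using branch_cover[of r u] that by auto
    ultimately show ?case
      by (intro exI[of _ "{r}"]) auto
  next
    case (Suc n)
    then obtain T L where T: "card T = Suc n"
        "\<And>u. u \<notin> T \<Longrightarrow> \<exists>w. adj u w \<and> T \<subseteq> branch u w"
      and L: "sym L" "\<forall>v\<in>T. good v (L v)"
      by auto
    have "T \<noteq> UNIV" "T \<noteq> {}"
      using T(1) Suc.prems by auto
    have "\<exists>t u. t \<in> T \<and> u \<notin> T \<and> adj t u"
    proof (rule ccontr)
      assume none: "\<nexists>t u. t \<in> T \<and> u \<notin> T \<and> adj t u"
      obtain t where "t \<in> T"
        using \<open>T \<noteq> {}\<close> by blast
      have "x \<in> T" for x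
        using adj_connected[of t x]
      proof induction
        case base
        show ?case by fact
      next
        case (step y z)
        then show ?case
          using none by blast
      qed
      then show False
        using \<open>T \<noteq> UNIV\<close> by blast
    qed
    then obtain t u where tu: "t \<in> T" "u \<notin> T" "adj t u"
      by blast
    obtain w where w: "adj u w" "T \<subseteq> branch u w"
      using T(2) tu by blast
    have uniq: "w' = w" if "adj u w'" "w' \<in> T" for w'
      using branch_unique[of u w' w w'] w that root_in_branch by blast
    have uniq': "w' = t" if "adj u w'" "w' \<in> T" for w'
      using uniq[OF that] uniq[of t] tu adj_sym by blast
    obtain L' where "sym L'" "\<forall>v\<in>insert u T. good v (L' v)"
      using extend[OF L tu(2) _ uniq'] tu(3) adj_sym by blast
    moreover have "\<exists>w. adj u' w \<and> insert u T \<subseteq> branch u' w" if u': "u' \<notin> insert u T" for u'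
    proof -
      obtain w where w: "adj u' w" "T \<subseteq> branch u' w"
        using T(2) u' by blast
      have "u \<in> branch u' w"
        using branch_step[of t u' w u] w tu u' by blast
      then show ?thesis
        using w by blast
    qed
    moreover have "card (insert u T) = Suc (Suc n)"
      using T(1) tu(2) by simp
    ultimately show ?case
      by blast
  qed
  from this[of "card (UNIV :: 'v set) - 1"]
  obtain T L where "card T = card (UNIV :: 'v set)" "sym L" "\<forall>v\<in>T. good v (L v)"
    by (auto simp: Suc_leI finite_UNIV_card_ge_0)
  then show ?thesis
    using card_subset_eq[of UNIV T] by (auto simp: sym_def)
qed

end

section \<open>Arcs of a circle\<close>

text \<open>Half-open arcs of length \<open>d\<close> of the circle \<open>[0, 1)\<close>, starting (for \<open>True\<close>) or ending
  (for \<open>False\<close>) at the anchor \<open>p\<close>.\<close>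

definition circle_arc :: "real \<times> bool \<Rightarrow> real \<Rightarrow> real set" where
  "circle_arc l d =
     {u \<in> {0..<1}. if snd l then frac (u - fst l) < d else 1 - d \<le> frac (u - fst l)}"

definition flip :: "real \<times> bool \<Rightarrow> real \<times> bool" where
  "flip l = (fst l, \<not> snd l)"

lemma flip_flip: "flip (flip l) = l"
  by (simp add: flip_def)

text \<open>The complement of an arc hangs on the same anchor from the other side, and the half-open
  convention loses or doubles no endpoint. Hence \<open>flip\<close> gives the label of an edge seen
  from its other end.\<close>

lemma circle_arc_flip: "circle_arc (flip l) (1 - d) = {0..<1} - circle_arc l d"
  by (auto simp: circle_arc_def flip_def split: if_splits)

lemma circle_arc_mono: "d \<le> d' \<Longrightarrow> circle_arc l d \<subseteq> circle_arc l d'"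
  by (auto simp: circle_arc_def)

lemma circle_arc_subset: "circle_arc l d \<subseteq> {0..<1}"
  by (auto simp: circle_arc_def)

lemma circle_arc_borel [measurable]: "circle_arc l d \<in> sets borel"
proof -
  have "Measurable.pred borel (\<lambda>u. if snd l then frac (u - fst l) < d else 1 - d \<le> frac (u - fst l))"
    unfolding frac_def by measurable
  then show ?thesis
    unfolding circle_arc_def by measurable
qed

lemma frac_add_cases:
  fixes t q :: real
  assumes "0 \<le> q" "q < 1"
  shows "frac (t + q) = (if frac t + q < 1 then frac t + q else frac t + q - 1)"
  using assms frac_add[of t q] by (simp add: frac_eq[of q, THEN iffD2])

lemma frac_diff_cases:
  fixes t q :: real
  assumes "0 \<le> q" "q < 1"
  shows "frac (t - q) = (if q \<le> frac t then frac t - q else frac t - q + 1)"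
proof (cases "q \<le> frac t")
  case True
  then show ?thesis
    using assms frac_lt_1[of t] by (subst frac_unique_iff) (auto simp: frac_def)
next
  case False
  have "t - q - (frac t - q + 1) = of_int (\<lfloor>t\<rfloor> - 1)"
    by (simp add: frac_def)
  then have "t - q - (frac t - q + 1) \<in> \<int>"
    by (metis Ints_of_int)
  moreover have "0 \<le> frac t - q + 1" "frac t - q + 1 < 1"
    using False assms frac_ge_0[of t] by linarith+
  ultimately show ?thesis
    using False by (subst frac_unique_iff) auto
qed

text \<open>Within [0, 1) a starting arc is one interval, or two if it wraps past 1. An ending arc
  is the complement of a starting arc of length \<open>1 - d\<close>.\<close>

lemma measure_circle_arc:
  assumes "0 \<le> d" "d \<le> 1"
  shows "measure lborel (circle_arc l d) = d"
proof -
  have start: "measure lborel (circle_arc (p, True) d) = d" if "0 \<le> d" "d \<le> 1" for p d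
  proof -
    define q where "q = frac p"
    have q: "0 \<le> q" "q < 1"
      by (simp_all add: q_def frac_lt_1)
    have frac_eq: "frac (u - p) = (if q \<le> u then u - q else u - q + 1)" if "u \<in> {0..<1}" for u
    proof -
      have "u - q = u - p + of_int \<lfloor>p\<rfloor>"
        by (simp add: q_def frac_def)
      then have "frac (u - p) = frac (u - q)"
        by (simp only: frac_add_of_int_right)
      moreover have "frac u = u"
        using that by (simp add: frac_eq)
      ultimately show ?thesis
        using frac_diff_cases[OF q, of u] by simp
    qed
    show ?thesis
    proof (cases "q + d \<le> 1")
      case True
      then have "circle_arc (p, True) d = {q..<q + d}"
        using q that by (auto simp: circle_arc_def frac_eq split: if_splits)
      then show ?thesis
        using that by simp
    next
      case False
      then have eq: "circle_arc (p, True) d = {q..<1} \<union> {0..<q + d - 1}"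
        using q that by (auto simp: circle_arc_def frac_eq split: if_splits)
      show ?thesis
        unfolding eq using q that False
        by (subst measure_Union) auto
    qed
  qed
  show ?thesis
  proof (cases "snd l")
    case True
    then show ?thesis
      using start[OF assms, of "fst l"] by (metis prod.collapse)
  next
    case False
    have "circle_arc l d = {0..<1} - circle_arc (fst l, True) (1 - d)"
      using circle_arc_flip[of "(fst l, True)" "1 - d"] False by (simp add: flip_def circle_arc_def)
    also have "measure lborel \<dots> = measure lborel {0..<1::real} - measure lborel (circle_arc (fst l, True) (1 - d))"
      by (rule measure_Diff) (auto intro: subsetD[OF circle_arc_subset])
    finally show ?thesis
      using start[of "1 - d" "fst l"] assms by simp
  qed
qed

section \<open>Packing disjoint arcs on the circle\<close>

text \<open>The intervals are laid end to end on the line with \<open>w0\<close> first; each new one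
  starts at the total length of those already placed.\<close>

lemma packing_exists:
  fixes c :: "'b \<Rightarrow> real"
  assumes "finite F" "w0 \<in> F" "\<And>w. w \<in> F \<Longrightarrow> 0 \<le> c w"
  shows "\<exists>q. q w0 = 0 \<and> (\<forall>w\<in>F. 0 \<le> q w \<and> q w + c w \<le> sum c F) \<and>
    (\<forall>w\<in>F. \<forall>w'\<in>F. w \<noteq> w' \<longrightarrow> q w + c w \<le> q w' \<or> q w' + c w' \<le> q w)"
proof -
  define packs where "packs q G \<longleftrightarrow> q w0 = 0 \<and> (\<forall>w\<in>G. 0 \<le> q w \<and> q w + c w \<le> sum c G) \<and>
    (\<forall>w\<in>G. \<forall>w'\<in>G. w \<noteq> w' \<longrightarrow> q w + c w \<le> q w' \<or> q w' + c w' \<le> q w)" for q G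
  \<comment> \<open>Keeping \<open>w0\<close> outside the set of the induction puts it at position 0
    from the start.\<close>
  have "\<exists>q. packs q (insert w0 G)" if "finite G" "w0 \<notin> G" "\<forall>w\<in>insert w0 G. 0 \<le> c w" for G
    using that
  proof (induction G)
    case empty
    have "packs (\<lambda>_. 0) {w0}"
      by (simp add: packs_def)
    then show ?case
      by blast
  next
    case (insert x G)
    then obtain q where q: "packs q (insert w0 G)"
      by auto
    have sum: "sum c (insert w0 (insert x G)) = c x + sum c (insert w0 G)"
      using insert by (subst insert_commute, subst sum.insert) auto
    have nonneg: "0 \<le> sum c (insert w0 G)" "0 \<le> c x"
      using insert.prems by (auto intro: sum_nonneg simp del: sum.insert)
    have x: "x \<notin> insert w0 G"
      using insert by auto
    define q' where "q' = q(x := sum c (insert w0 G))"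
    have q'x: "q' x = sum c (insert w0 G)" and q'G: "\<And>w. w \<in> insert w0 G \<Longrightarrow> q' w = q w"
      using x by (auto simp: q'_def)
    have old: "0 \<le> q' w" "q' w + c w \<le> q' x" if "w \<in> insert w0 G" for w
      using q that q'G[OF that] unfolding packs_def q'x by auto
    have "packs q' (insert x (insert w0 G))"
      unfolding packs_def
    proof (intro conjI ballI impI)
      show "q' w0 = 0"
        using q q'G[of w0] by (simp add: packs_def)
    next
      fix w assume w: "w \<in> insert x (insert w0 G)"
      then show "0 \<le> q' w"
        using old(1) nonneg q'x by auto
      show "q' w + c w \<le> sum c (insert x (insert w0 G))"
        using w old(2)[of w] nonneg q'x sum by (auto simp: insert_commute)
    next
      fix w w' assume "w \<in> insert x (insert w0 G)" "w' \<in> insert x (insert w0 G)" "w \<noteq> w'"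
      then consider "w = x" "w' \<in> insert w0 G" | "w' = x" "w \<in> insert w0 G"
        | "w \<in> insert w0 G" "w' \<in> insert w0 G"
        by blast
      then show "q' w + c w \<le> q' w' \<or> q' w' + c w' \<le> q' w"
      proof cases
        case 3
        then show ?thesis
          using q \<open>w \<noteq> w'\<close> q'G unfolding packs_def by metis
      qed (use old in auto)
    qed
    then show ?case
      by (auto simp: insert_commute)
  qed
  from this[of "F - {w0}"] have "\<exists>q. packs q F"
    using assms by (simp add: insert_absorb)
  then show ?thesis
    by (simp only: packs_def)
qed

text \<open>All arcs take the direction of \<open>l\<close>. The packing on the line is run forwards
  from the anchor \<open>fst l\<close> for starting arcs and backwards for ending arcs, so position
  0 gives \<open>w0\<close> exactly the label \<open>l\<close>.\<close>

lemma circle_packing_exists: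
  fixes c :: "'b \<Rightarrow> real"
  assumes F: "finite F" "w0 \<in> F" "\<And>w. w \<in> F \<Longrightarrow> 0 \<le> c w" "sum c F \<le> 1"
  shows "\<exists>K. K w0 = l \<and> disjoint_family_on (\<lambda>w. circle_arc (K w) (c w)) F"
proof -
  obtain q where pack: "q w0 = 0 \<and> (\<forall>w\<in>F. 0 \<le> q w \<and> q w + c w \<le> sum c F) \<and>
      (\<forall>w\<in>F. \<forall>w'\<in>F. w \<noteq> w' \<longrightarrow> q w + c w \<le> q w' \<or> q w' + c w' \<le> q w)"
    using packing_exists[where c = c, OF F(1-3)] ..
  then have q0: "q w0 = 0" and q: "\<forall>w\<in>F. 0 \<le> q w \<and> q w + c w \<le> sum c F"
    and sep: "\<forall>w\<in>F. \<forall>w'\<in>F. w \<noteq> w' \<longrightarrow> q w + c w \<le> q w' \<or> q w' + c w' \<le> q w"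
    by simp_all
  define K where "K w = (if snd l then fst l + q w else fst l - q w, snd l)" for w
  have "K w0 = l"
    by (cases l) (simp add: K_def q0)
  moreover have "circle_arc (K w) (c w) \<inter> circle_arc (K w') (c w') = {}"
    if "w \<in> F" "w' \<in> F" "w \<noteq> w'" for w w'
  proof -
    \<comment> \<open>In the coordinate \<open>frac (u - fst l)\<close> nothing wraps around,
      because \<open>q w + c w \<le> 1\<close>: each arc lies in its interval of the packing, or in
      the mirror image of that interval.\<close>
    have range: "(if snd l then q w \<le> frac (u - fst l) \<and> frac (u - fst l) < q w + c w
        else 1 - q w - c w \<le> frac (u - fst l) \<and> frac (u - fst l) < 1 - q w)"
      if u: "u \<in> circle_arc (K w) (c w)" and w: "w \<in> F" for u w
    proof -
      have b: "0 \<le> q w" "q w + c w \<le> 1" "0 \<le> c w"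
        using q w F(3)[OF w] F(4) by force+
      show ?thesis
      proof (cases "snd l")
        case True
        then have less: "frac (u - fst l - q w) < c w"
          using u by (simp add: circle_arc_def K_def diff_diff_eq)
        \<comment> \<open>The case rule for \<open>frac\<close> needs \<open>q w < 1\<close>.
          Position 1 would leave room only for length 0, and that arc is empty.\<close>
        then have "0 < c w"
          using frac_ge_0[of "u - fst l - q w"] by linarith
        then have "q w < 1"
          using b by simp
        then have "q w \<le> frac (u - fst l) \<and> frac (u - fst l) < q w + c w"
          using less frac_diff_cases[OF b(1), of "u - fst l"] b frac_ge_0[of "u - fst l"]
          by (smt (verit))
        then show ?thesis
          using True by simp
      next
        case False
        then have le: "1 - c w \<le> frac (u - fst l + q w)"
          using u by (simp add: circle_arc_def K_def diff_diff_eq2 add_diff_eq diff_add_eq)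
        then have "0 < c w"
          using frac_lt_1[of "u - fst l + q w"] by linarith
        then have "q w < 1"
          using b by simp
        then have "1 - q w - c w \<le> frac (u - fst l) \<and> frac (u - fst l) < 1 - q w"
          using le frac_add_cases[OF b(1), of "u - fst l"] b frac_lt_1[of "u - fst l"]
          by (smt (verit))
        then show ?thesis
          using False by simp
      qed
    qed
    show ?thesis
    proof (rule equals0I)
      fix u assume "u \<in> circle_arc (K w) (c w) \<inter> circle_arc (K w') (c w')"
      then show False
        using range[of u w] range[of u w'] sep[rule_format, OF that] that by (cases "snd l") auto
    qed
  qed
  ultimately show ?thesis
    unfolding disjoint_family_on_def by blast
qed

text \<open>Two arcs leaving one anchor in opposite directions can meet only if together they are
  longer than the circle.\<close>

lemma circle_arc_opposite_disjoint:
  assumes "d + d' \<le> 1"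
  shows "circle_arc l d \<inter> circle_arc (flip l) d' = {}"
  using assms by (auto simp: circle_arc_def flip_def split: if_splits)

section \<open>Hasse trees\<close>

definition hasse_adj :: "'a::order \<Rightarrow> 'a \<Rightarrow> bool" where
  "hasse_adj x y \<longleftrightarrow> covered_by UNIV x y \<or> covered_by UNIV y x"

text \<open>Connectedness carries over because symmetrizing a symmetric graph changes nothing. A
  path avoiding \<open>v\<close> between two distinct neighbours of \<open>v\<close> closes up
  through \<open>v\<close> to a forbidden cycle.\<close>

lemma undirected_tree_finite_tree:
  fixes adj :: "'v::finite \<Rightarrow> 'v \<Rightarrow> bool"
  assumes sym: "\<And>v w. adj v w \<Longrightarrow> adj w v" and irrefl: "\<And>v. \<not> adj v v"
    and tree: "undirected_tree (with_proj \<lparr>pverts = UNIV, parcs = {(x, y). adj x y}\<rparr>)"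
  shows "finite_tree adj"
proof
  let ?G = "\<lparr>pverts = UNIV, parcs = {(x, y). adj x y}\<rparr>"
  interpret G: pair_wf_digraph ?G
    by unfold_locales auto
  show "adj\<^sup>*\<^sup>* v w" for v w
  proof -
    have "mk_symmetric (with_proj ?G) = ?G"
      unfolding mk_symmetric_def using sym by auto
    then have "v \<rightarrow>\<^sup>*\<^bsub>with_proj ?G\<^esub> w"
      using tree unfolding undirected_tree_def connected_def strongly_connected_def by simp
    then have "(v, w) \<in> {(x, y). adj x y}\<^sup>*"
      by (auto simp: reachable_def dest: rtrancl_on_rtranclI)
    then show ?thesis
      by (simp add: rtranclp_rtrancl_eq)
  qed
  show "w = w'" if adj: "adj v w" "adj v w'"
    and path: "(\<lambda>a b. adj a b \<and> a \<noteq> v \<and> b \<noteq> v)\<^sup>*\<^sup>* w w'" for v w w'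
  proof (rule ccontr)
    assume "w \<noteq> w'"
    \<comment> \<open>In the graph with \<open>v\<close> deleted, walks avoid \<open>v\<close>
      automatically, and so does the path left after removing loops.\<close>
    let ?H = "\<lparr>pverts = UNIV - {v}, parcs = {(x, y). adj x y \<and> x \<noteq> v \<and> y \<noteq> v}\<rparr>"
    interpret H: pair_wf_digraph ?H
      by unfold_locales auto
    have "w \<noteq> v"
      using adj irrefl by blast
    have "\<exists>p. H.awalk w p w'"
      using path
    proof induction
      case base
      show ?case
        using \<open>w \<noteq> v\<close> by (intro exI[of _ "[]"]) (simp add: H.awalk_Nil_iff)
    next
      case (step y z)
      then obtain p where "H.awalk w p y"
        by blast
      moreover have "H.awalk y [(y, z)] z"
        using step by (simp add: H.awalk_def)
      ultimately show ?case
        using H.awalk_appendI by blast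
    qed
    then obtain p0 where p0: "H.awalk w p0 w'" ..
    define p where "p = H.awalk_to_apath p0"
    have "H.apath w p w'"
      unfolding p_def using p0 by (rule H.apath_awalk_to_apath)
    then have p: "H.awalk w p w'" "distinct (pawalk_verts w p)"
      by (simp_all add: H.apath_def)
    then have "set (pawalk_verts w p) \<subseteq> UNIV - {v}"
      by (elim H.awalkE) simp
    then have v: "v \<notin> set (pawalk_verts w p)"
      by blast
    have "p \<noteq> []"
      using p(1) \<open>w \<noteq> w'\<close> H.awalk_Nil_iff[of w w'] by blast
    have w_w': "G.awalk w p w'"
      using p(1) unfolding H.awalk_def G.awalk_def by auto
    have vw: "G.awalk v [(v, w)] w" and w'v: "G.awalk w' [(w', v)] v"
      using adj sym by (simp_all add: G.awalk_def)
    have "G.awalk v ([(v, w)] @ p @ [(w', v)]) v"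
      by (rule G.awalk_appendI[OF vw G.awalk_appendI[OF w_w' w'v]])
    moreover have "pawalk_verts u (q @ [(w', v)]) = pawalk_verts u q @ [v]" if "pcas u q w'" for u q
      using that by (induction q arbitrary: u) auto
    then have "pawalk_verts w (p @ [(w', v)]) = pawalk_verts w p @ [v]"
      using w_w' by (simp add: G.awalk_def)
    ultimately have "G.cycle ((v, w) # p @ [(w', v)])"
      unfolding G.cycle_def using p(2) v by (intro exI[of _ v]) auto
    \<comment> \<open>As \<open>w\<close> and \<open>w'\<close> differ, \<open>p\<close> has an arc;
      the two arcs at \<open>v\<close> bring the total to 3.\<close>
    moreover have "length ((v, w) # p @ [(w', v)]) \<ge> 3"
      using \<open>p \<noteq> []\<close> by (cases p) auto
    ultimately show False
      using tree unfolding undirected_tree_def by blast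
  qed
qed (use assms in auto)

lemma hasse_finite_tree:
  assumes "undirected_tree (hasse_diagram (UNIV :: 's::{finite, order} set))"
  shows "finite_tree (hasse_adj :: 's \<Rightarrow> 's \<Rightarrow> bool)"
  using assms unfolding hasse_diagram_def hasse_adj_def
  by (intro undirected_tree_finite_tree) (auto simp: covered_by_def)

section \<open>Cover chains and up-sets\<close>

text \<open>A minimal element of \<open>{z. x < z \<and> z \<le> y}\<close> covers \<open>x\<close>,
  and the interval from it up to \<open>y\<close> is smaller.\<close>

lemma rtranclp_covered_by:
  fixes x y :: "'s::{finite, order}"
  assumes "x \<le> y" shows "(covered_by UNIV)\<^sup>*\<^sup>* x y"
  using assms
proof (induction "card {x..y}" arbitrary: x rule: less_induct)
  case less
  show ?case
  proof (cases "x = y")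
    case False
    then have "{z. x < z \<and> z \<le> y} \<noteq> {}"
      using less.prems by (auto simp: less_le)
    then have "\<exists>z\<in>{z. x < z \<and> z \<le> y}. \<forall>z'\<in>{z. x < z \<and> z \<le> y}. z' \<le> z \<longrightarrow> z = z'"
      by (intro finite_has_minimal) simp_all
    then obtain z where "z \<in> {z. x < z \<and> z \<le> y}"
        and min: "\<forall>z'\<in>{z. x < z \<and> z \<le> y}. z' \<le> z \<longrightarrow> z = z'" ..
    then have z: "x < z" "z \<le> y"
      by simp_all
    have "covered_by UNIV x z"
      unfolding covered_by_def
    proof (intro conjI notI UNIV_I)
      assume "\<exists>z'\<in>UNIV. x < z' \<and> z' < z"
      then obtain z' where z': "x < z'" "z' < z"
        by blast
      then have "z = z'"
        using min z(2) by (simp add: less_imp_le order.trans[of z' z y])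
      then show False
        using z' by simp
    qed (rule z(1))
    moreover have "card {z..y} < card {x..y}"
      using z less.prems by (intro psubset_card_mono) auto
    ultimately show ?thesis
      using less.hyps z by (meson converse_rtranclp_into_rtranclp)
  qed simp
qed

lemma hasse_adj_cases:
  assumes "hasse_adj v w"
  obtains "covered_by UNIV v w" "v < w" | "covered_by UNIV w v" "w < v"
  using assms by (auto simp: hasse_adj_def covered_by_def)

text \<open>It suffices to go up one cover at a time. The only exit from the branch is the edge from
  \<open>w\<close> to \<open>v\<close>, and that edge leads down.\<close>

lemma up_set_branch:
  fixes v w :: "'s::{finite, order}"
  assumes tree: "finite_tree (hasse_adj :: 's \<Rightarrow> 's \<Rightarrow> bool)"
    and cov: "covered_by UNIV v w"
  shows "up_set (finite_tree.branch hasse_adj v w)"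
proof -
  interpret finite_tree "hasse_adj :: 's \<Rightarrow> 's \<Rightarrow> bool"
    by (rule tree)
  have adj: "hasse_adj v w"
    using cov by (simp add: hasse_adj_def)
  have "y \<in> branch v w" if "x \<in> branch v w" "x \<le> y" for x y
    using rtranclp_covered_by[OF that(2)] that(1)
  proof induction
    case (step y z)
    then have y: "y \<in> branch v w"
      by simp
    then have "y \<noteq> v"
      using notin_branch[OF adj] by blast
    have yz: "hasse_adj y z"
      using step(2) by (simp add: hasse_adj_def)
    have "z \<noteq> v"
    proof
      assume "z = v"
      then have "hasse_adj v y"
        using adj_sym[OF yz] by simp
      then have "y = w"
        using adj root_in_branch y by (rule branch_unique)
      then show False
        using step(2) cov \<open>z = v\<close> by (auto simp: covered_by_def)
    qed
    then show ?case
      by (rule branch_step[OF y yz \<open>y \<noteq> v\<close>])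
  qed
  then show ?thesis
    by (auto simp: up_set_def)
qed

section \<open>Vertex degrees in the absence of Y-posets and W-star posets\<close>

lemma covered_by_subset:
  "\<lbrakk>covered_by T x y; S \<subseteq> T; x \<in> S; y \<in> S\<rbrakk> \<Longrightarrow> covered_by S x y"
  unfolding covered_by_def by blast

lemma covers_incomparable:
  assumes "covered_by UNIV v x" "covered_by UNIV v y" "x \<noteq> y"
  shows "\<not> x \<le> y"
  using assms by (auto simp: covered_by_def less_le)

lemma cocovers_incomparable:
  assumes "covered_by UNIV x v" "covered_by UNIV y v" "x \<noteq> y"
  shows "\<not> x \<le> y"
  using assms by (auto simp: covered_by_def less_le)

lemma card_ge_3_distinct:
  assumes "\<not> card N \<le> 2"
  shows "\<exists>x\<in>N. \<exists>y\<in>N. \<exists>z\<in>N. x \<noteq> y \<and> x \<noteq> z \<and> y \<noteq> z"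
proof -
  obtain T where "T \<subseteq> N" "card T = 3"
    using assms obtain_subset_with_card_n[of 3 N] by (metis Suc_leI not_le numeral_2_eq_2 numeral_3_eq_3)
  then show ?thesis
    unfolding card_3_iff by blast
qed

text \<open>If \<open>v\<close> had neighbours both above and below, then of at least three
  neighbours two would lie on the same side, and with \<open>v\<close> and one from the other side
  they would form a Y-poset.\<close>

lemma no_Y_poset_branching:
  fixes v :: "'s::order"
  assumes no_Y: "\<And>T :: 's set. \<not> Y_poset T" and deg: "\<not> card {w. hasse_adj v w} \<le> 2"
  shows "(\<forall>w. hasse_adj v w \<longrightarrow> covered_by UNIV v w) \<or> (\<forall>w. hasse_adj v w \<longrightarrow> covered_by UNIV w v)"
proof -
  have Y: False if "covered_by UNIV w v" "covered_by UNIV v x" "covered_by UNIV v y" "x \<noteq> y" for w x y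
  proof -
    have inc: "\<not> x \<le> y" "\<not> y \<le> x"
      by (rule covers_incomparable[OF that(2,3,4)], rule covers_incomparable[OF that(3,2) that(4)[symmetric]])
    have less: "w < v" "v < x" "v < y"
      using that by (simp_all add: covered_by_def)
    then have "card {w, v, x, y} = 4"
      using that(4) less_trans[OF less(1) less(2)] less_trans[OF less(1) less(3)]
      by (auto simp: card_insert_if)
    moreover have "covered_by {w, v, x, y} w v" "covered_by {w, v, x, y} v x" "covered_by {w, v, x, y} v y"
      using that(1-3) by (auto intro: covered_by_subset)
    ultimately have "Y_poset {w, v, x, y}"
      unfolding Y_poset_def using inc by blast
    then show False
      using no_Y by blast
  qed
  have Y': False if "covered_by UNIV v w" "covered_by UNIV x v" "covered_by UNIV y v" "x \<noteq> y" for w x y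
  proof -
    have inc: "\<not> x \<le> y" "\<not> y \<le> x"
      by (rule cocovers_incomparable[OF that(2,3,4)], rule cocovers_incomparable[OF that(3,2) that(4)[symmetric]])
    have less: "v < w" "x < v" "y < v"
      using that by (simp_all add: covered_by_def)
    then have "card {w, v, x, y} = 4"
      using that(4) less_trans[OF less(2) less(1)] less_trans[OF less(3) less(1)]
      by (auto simp: card_insert_if)
    moreover have "covered_by {w, v, x, y} v w" "covered_by {w, v, x, y} x v" "covered_by {w, v, x, y} y v"
      using that(1-3) by (auto intro: covered_by_subset)
    ultimately have "Y_poset {w, v, x, y}"
      unfolding Y_poset_def using inc by blast
    then show False
      using no_Y by blast
  qed
  obtain x y z where xyz: "hasse_adj v x" "hasse_adj v y" "hasse_adj v z" "x \<noteq> y" "x \<noteq> z" "y \<noteq> z"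
    using card_ge_3_distinct[OF deg] by blast
  show ?thesis
  proof (rule ccontr)
    assume "\<not> ?thesis"
    then obtain a b where "covered_by UNIV a v" "covered_by UNIV v b"
      by (auto simp: hasse_adj_def)
    \<comment> \<open>Two of \<open>x\<close>, \<open>y\<close>, \<open>z\<close> are on the same
      side of \<open>v\<close>; the element needed on the opposite side is \<open>a\<close> or
      \<open>b\<close>.\<close>
    then show False
      using Y[of a] Y'[of b] xyz unfolding hasse_adj_def by metis
  qed
qed

text \<open>Distinct covers of \<open>v\<close> are incomparable, so three of them together with
  \<open>v\<close> would form the forbidden poset.\<close>

lemma no_W_upper_star_degree:
  fixes v :: "'s::order"
  assumes no_W: "\<And>T :: 's set. \<not> W_upper_star_poset T" and up: "\<And>w. hasse_adj v w \<Longrightarrow> covered_by UNIV v w"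
  shows "card {w. hasse_adj v w} \<le> 2"
proof (rule ccontr)
  assume "\<not> ?thesis"
  then obtain x y z where xyz: "covered_by UNIV v x" "covered_by UNIV v y" "covered_by UNIV v z"
      and ne: "x \<noteq> y" "x \<noteq> z" "y \<noteq> z"
    using card_ge_3_distinct[of "{w. hasse_adj v w}"] up by blast
  have less: "v < x" "v < y" "v < z"
    using xyz by (auto simp: covered_by_def)
  have anti: "\<not> a < b" if "a \<in> {x, y, z}" "b \<in> {x, y, z}" for a b
    using that covers_incomparable[of v a b] xyz by (auto simp: less_le)
  have "a < b \<longleftrightarrow> a = v \<and> b \<in> {x, y, z}" if "a \<in> {v, x, y, z}" "b \<in> {v, x, y, z}" for a b
    using that anti[of a b] less less_asym by (metis insert_iff order.irrefl singletonD)
  moreover have "card {v, x, y, z} = 4"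
    using ne less by (auto simp: card_insert_if)
  ultimately have "W_upper_star_poset {v, x, y, z}"
    unfolding W_upper_star_poset_def by blast
  then show False
    using no_W by blast
qed

lemma no_W_lower_star_degree:
  fixes v :: "'s::order"
  assumes no_W: "\<And>T :: 's set. \<not> W_lower_star_poset T" and down: "\<And>w. hasse_adj v w \<Longrightarrow> covered_by UNIV w v"
  shows "card {w. hasse_adj v w} \<le> 2"
proof (rule ccontr)
  assume "\<not> ?thesis"
  then obtain x y z where xyz: "covered_by UNIV x v" "covered_by UNIV y v" "covered_by UNIV z v"
      and ne: "x \<noteq> y" "x \<noteq> z" "y \<noteq> z"
    using card_ge_3_distinct[of "{w. hasse_adj v w}"] down by blast
  have less: "x < v" "y < v" "z < v"
    using xyz by (auto simp: covered_by_def)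
  have anti: "\<not> a < b" if "a \<in> {x, y, z}" "b \<in> {x, y, z}" for a b
    using that cocovers_incomparable[of a v b] xyz by (auto simp: less_le)
  have "a < b \<longleftrightarrow> a \<in> {x, y, z} \<and> b = v" if "a \<in> {v, x, y, z}" "b \<in> {v, x, y, z}" for a b
    using that anti[of a b] less less_asym by (metis insert_iff order.irrefl singletonD)
  moreover have "card {v, x, y, z} = 4"
    using ne less by (auto simp: card_insert_if)
  ultimately have "W_lower_star_poset {v, x, y, z}"
    unfolding W_lower_star_poset_def by blast
  then show False
    using no_W by blast
qed

section \<open>The coupling\<close>

text \<open>The branches at \<open>v\<close> partition the complement of \<open>v\<close>. So
  disjoint arcs of these lengths leave uncovered exactly the mass of \<open>v\<close>.\<close>

lemma sum_branch_prob_le_1: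
  fixes p :: "'s::{finite, order} pmf"
  assumes "finite_tree (hasse_adj :: 's \<Rightarrow> 's \<Rightarrow> bool)"
  shows "pmf p v + (\<Sum>w | hasse_adj v w. measure_pmf.prob p (finite_tree.branch hasse_adj v w)) = 1"
proof -
  interpret finite_tree "hasse_adj :: 's \<Rightarrow> 's \<Rightarrow> bool"
    by fact
  let ?N = "{w. hasse_adj v w}"
  have "measure_pmf.prob p (\<Union>w\<in>?N. branch v w) = (\<Sum>w\<in>?N. measure_pmf.prob p (branch v w))"
    using branch_unique[of v]
    by (intro measure_pmf.finite_measure_finite_Union) (auto simp: disjoint_family_on_def)
  moreover have "(\<Union>w\<in>?N. branch v w) = UNIV - {v}"
    using branch_cover[of _ v] notin_branch[of v] by blast
  moreover have "measure_pmf.prob p (UNIV - {v}) = 1 - pmf p v"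
    using measure_pmf.prob_compl[of "{v}" p] by (simp add: measure_pmf_single)
  ultimately show ?thesis
    by simp
qed

text \<open>The law \<open>p\<close> in \<open>bound\<close> is an envelope at a vertex of degree at
  least 3: its branch probabilities sum to at most 1, so arcs of these lengths can be packed
  disjointly, and they contain the arcs of every \<alpha>.\<close>

lemma realization_exists:
  fixes P :: "'a::{finite, order} \<Rightarrow> 's::{finite, order} pmf"
  assumes tree: "finite_tree (hasse_adj :: 's \<Rightarrow> 's \<Rightarrow> bool)"
    and mono: "stochastically_monotone P"
    and bound: "\<And>v :: 's. \<not> card {w. hasse_adj v w} \<le> 2 \<Longrightarrow> \<exists>p :: 's pmf. \<forall>\<alpha> w. hasse_adj v w \<longrightarrow>
       measure_pmf.prob (P \<alpha>) (finite_tree.branch hasse_adj v w)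
         \<le> measure_pmf.prob p (finite_tree.branch hasse_adj v w)"
  shows "realizably_monotone P"
proof -
  interpret finite_tree "hasse_adj :: 's \<Rightarrow> 's \<Rightarrow> bool"
    by (rule tree)
  define m where "m \<alpha> v w = measure_pmf.prob (P \<alpha>) (branch v w)" for \<alpha> v w
  have m_nonneg: "0 \<le> m \<alpha> v w" and m_le_1: "m \<alpha> v w \<le> 1" for \<alpha> v w
    by (simp_all add: m_def)
  have m_sum: "pmf (P \<alpha>) v + (\<Sum>w | hasse_adj v w. m \<alpha> v w) = 1" for \<alpha> v
    unfolding m_def by (rule sum_branch_prob_le_1[OF tree])
  have m_flip: "m \<alpha> w v = 1 - m \<alpha> v w" if "hasse_adj v w" for \<alpha> v w
    using measure_pmf.prob_compl[of "branch v w" "P \<alpha>"] branch_compl[OF that]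
    by (simp add: m_def Compl_eq_Diff_UNIV)
  have m_up: "m \<alpha> v w \<le> m \<beta> v w" if "\<alpha> < \<beta>" "covered_by UNIV v w" for \<alpha> \<beta> v w
    using mono up_set_branch[OF tree that(2)] that(1)
    unfolding stochastically_monotone_def stochastically_le_def m_def by blast

  \<comment> \<open>A single labelling \<open>K\<close> has to serve all \<alpha>; only the lengths
    of the arcs vary.\<close>
  define good where "good v K \<longleftrightarrow>
    (\<forall>\<alpha>. disjoint_family_on (\<lambda>w. circle_arc (K w) (m \<alpha> v w)) {w. hasse_adj v w})" for v K
  have star: "\<exists>K. K w = l \<and> good v K" if adj: "hasse_adj v w" for v w l
  proof (cases "card {w. hasse_adj v w} \<le> 2")
    case True
    \<comment> \<open>The other arc, if there is one, leaves the anchor of \<open>l\<close> in the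
      opposite direction.\<close>
    define K where "K w' = (if w' = w then l else flip l)" for w'
    have disj: "circle_arc (K w) (m \<alpha> v w) \<inter> circle_arc (K w') (m \<alpha> v w') = {}"
      if "hasse_adj v w'" "w' \<noteq> w" for w' \<alpha>
    proof -
      have "(\<Sum>x\<in>{w, w'}. m \<alpha> v x) \<le> (\<Sum>x | hasse_adj v x. m \<alpha> v x)"
        using adj that m_nonneg by (intro sum_mono2) auto
      also have "\<dots> \<le> 1"
        using m_sum[of \<alpha> v] pmf_nonneg[of "P \<alpha>" v] by linarith
      finally have "m \<alpha> v w + m \<alpha> v w' \<le> 1"
        using that by simp
      then show ?thesis
        using circle_arc_opposite_disjoint that by (simp add: K_def)
    qed
    have two: "x = w \<or> y = w" if "hasse_adj v x" "hasse_adj v y" "x \<noteq> y" for x y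
    proof (rule ccontr)
      assume "\<not> ?thesis"
      then have "card {w, x, y} = 3"
        using that by (auto simp: card_insert_if)
      moreover have "card {w, x, y} \<le> card {w. hasse_adj v w}"
        using adj that by (intro card_mono) auto
      ultimately show False
        using True by simp
    qed
    have "good v K"
      unfolding good_def disjoint_family_on_def
    proof (intro allI ballI impI)
      fix \<alpha> x y assume xy: "x \<in> {w. hasse_adj v w}" "y \<in> {w. hasse_adj v w}" "x \<noteq> y"
      then consider "x = w" "y \<noteq> w" | "y = w" "x \<noteq> w"
        using two by blast
      then show "circle_arc (K x) (m \<alpha> v x) \<inter> circle_arc (K y) (m \<alpha> v y) = {}"
        using disj[of y \<alpha>] disj[of x \<alpha>] xy by cases (simp_all add: Int_commute)
    qed
    moreover have "K w = l"
      by (simp add: K_def)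
    ultimately show ?thesis
      by blast
  next
    case False
    obtain p :: "'s pmf" where p: "\<forall>\<alpha> w. hasse_adj v w \<longrightarrow> m \<alpha> v w \<le> measure_pmf.prob p (branch v w)"
      using bound[OF False] unfolding m_def ..
    have "(\<Sum>w | hasse_adj v w. measure_pmf.prob p (branch v w)) \<le> 1"
      using sum_branch_prob_le_1[OF tree, of p v] pmf_nonneg[of p v] by linarith
    then have "\<exists>K. K w = l \<and>
        disjoint_family_on (\<lambda>w. circle_arc (K w) (measure_pmf.prob p (branch v w))) {w. hasse_adj v w}"
      using adj by (intro circle_packing_exists) auto
    then obtain K where K: "K w = l \<and>
        disjoint_family_on (\<lambda>w. circle_arc (K w) (measure_pmf.prob p (branch v w))) {w. hasse_adj v w}" ..
    have "good v K"
      unfolding good_def disjoint_family_on_def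
    proof (intro allI ballI impI)
      fix \<alpha> x y assume xy: "x \<in> {w. hasse_adj v w}" "y \<in> {w. hasse_adj v w}" "x \<noteq> y"
      have sub: "circle_arc (K x) (m \<alpha> v x) \<subseteq> circle_arc (K x) (measure_pmf.prob p (branch v x))"
        if "x \<in> {w. hasse_adj v w}" for x
        using p that by (intro circle_arc_mono) simp
      have "circle_arc (K x) (measure_pmf.prob p (branch v x)) \<inter>
          circle_arc (K y) (measure_pmf.prob p (branch v y)) = {}"
        using K xy unfolding disjoint_family_on_def by blast
      then show "circle_arc (K x) (m \<alpha> v x) \<inter> circle_arc (K y) (m \<alpha> v y) = {}"
        using sub[OF xy(1)] sub[OF xy(2)] by blast
    qed
    then show ?thesis
      using K by blast
  qed
  have "\<exists>L. (\<forall>v w. hasse_adj v w \<longrightarrow> L w v = flip (L v w)) \<and> (\<forall>v. good v (L v))"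
  proof (rule labelling_exists)
    \<comment> \<open>Initial labels: anchor 0 everywhere, with the order deciding the direction so
      that the two ends of an edge receive flipped labels.\<close>
    show "(0, w < v) = flip (0, v < w)" if "hasse_adj v w" for v w :: 's
      using that by (rule hasse_adj_cases) (auto simp: flip_def)
    show "good v K'" if "\<And>w. hasse_adj v w \<Longrightarrow> K w = K' w" "good v K" for v K K'
      using that unfolding good_def disjoint_family_on_def by simp
    show "good v K" if "\<And>w. \<not> hasse_adj v w" for v K
      using that unfolding good_def disjoint_family_on_def by simp
  qed (rule flip_flip, rule star)
  then obtain L where L: "(\<forall>v w. hasse_adj v w \<longrightarrow> L w v = flip (L v w)) \<and> (\<forall>v. good v (L v))" ..

  define out where "out \<alpha> u v w \<longleftrightarrow> u \<in> circle_arc (L v w) (m \<alpha> v w)" for \<alpha> u v w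
  have orient: "orientation (out \<alpha> u)" if u: "u \<in> {0..<1}" for \<alpha> u
    unfolding orientation_def
  proof (intro conjI allI impI)
    fix v w :: 's assume adj: "hasse_adj v w"
    \<comment> \<open>Seen from the other end, the label is flipped and the length becomes
      \<open>1 - m \<alpha> v w\<close>, so the arc is complemented and the edge has exactly one
      direction.\<close>
    have "circle_arc (L w v) (m \<alpha> w v) = {0..<1} - circle_arc (L v w) (m \<alpha> v w)"
      using L adj by (simp add: m_flip circle_arc_flip)
    then show "out \<alpha> u v w \<longleftrightarrow> \<not> out \<alpha> u w v"
      using u by (simp add: out_def)
  next
    fix v w w' :: 's assume *: "hasse_adj v w \<and> hasse_adj v w' \<and> out \<alpha> u v w \<and> out \<alpha> u v w'"
    show "w = w'"
    proof (rule ccontr)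
      assume "w \<noteq> w'"
      then have "circle_arc (L v w) (m \<alpha> v w) \<inter> circle_arc (L v w') (m \<alpha> v w') = {}"
        using L * unfolding good_def disjoint_family_on_def by blast
      then show False
        using * by (auto simp: out_def)
    qed
  qed
  \<comment> \<open>Off [0, 1) no arc contains \<open>u\<close>, so every vertex is a sink and the
    choice is arbitrary; such points lie outside the sample space.\<close>
  define X where "X \<alpha> u = (SOME x. sink (out \<alpha> u) x)" for \<alpha> u
  have sink_X: "sink (out \<alpha> u) (X \<alpha> u)" if "u \<in> {0..<1}" for \<alpha> u
    unfolding X_def by (rule someI_ex[OF sink_exists[OF orient[OF that]]])
  have X_eq_iff: "X \<alpha> u = x \<longleftrightarrow> sink (out \<alpha> u) x" if "u \<in> {0..<1}" for \<alpha> u x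
    using sink_X[OF that] sink_unique[OF orient[OF that] sink_X[OF that]] by blast

  define M where "M = restrict_space lborel {0..<1::real}"
  have space_M: "space M = {0..<1}"
    by (simp add: M_def space_restrict_space)
  interpret M: prob_space M
    by (intro prob_spaceI) (simp add: space_M M_def emeasure_restrict_space)
  \<comment> \<open>The value is \<open>x\<close> exactly when \<open>u\<close> avoids all arcs
    leaving \<open>x\<close>. These are disjoint with total length
    \<open>1 - pmf (P \<alpha>) x\<close>, which yields the law.\<close>
  have fiber: "X \<alpha> -` {x} \<inter> space M = {0..<1} - (\<Union>w\<in>{w. hasse_adj x w}. circle_arc (L x w) (m \<alpha> x w))"
    for \<alpha> x
  proof (rule set_eqI)
    fix u
    show "u \<in> X \<alpha> -` {x} \<inter> space M \<longleftrightarrow>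
        u \<in> {0..<1} - (\<Union>w\<in>{w. hasse_adj x w}. circle_arc (L x w) (m \<alpha> x w))"
    proof (cases "u \<in> {0..<1}")
      case True
      then have "X \<alpha> u = x \<longleftrightarrow> (\<forall>w. hasse_adj x w \<longrightarrow> u \<notin> circle_arc (L x w) (m \<alpha> x w))"
        by (simp only: X_eq_iff sink_def out_def)
      then show ?thesis
        using True by (simp add: space_M)
    qed (auto simp: space_M)
  qed
  have fiber_sets: "X \<alpha> -` {x} \<inter> space M \<in> sets M" for \<alpha> x
    unfolding fiber unfolding M_def
    by (subst sets_restrict_space_iff) (auto intro!: sets.Diff sets.finite_UN circle_arc_borel)
  have X_meas: "X \<alpha> \<in> M \<rightarrow>\<^sub>M count_space UNIV" for \<alpha>
    using fiber_sets by (subst measurable_count_space_eq2) auto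
  have fiber_measure: "measure M (X \<alpha> -` {x} \<inter> space M) = pmf (P \<alpha>) x" for \<alpha> x
  proof -
    let ?N = "{w. hasse_adj x w}"
    let ?U = "\<Union>w\<in>?N. circle_arc (L x w) (m \<alpha> x w)"
    have finite_arc: "emeasure lborel (circle_arc l d) \<noteq> \<infinity>" for l d
    proof -
      have "emeasure lborel (circle_arc l d) \<le> emeasure lborel {0..<1::real}"
        by (intro emeasure_mono circle_arc_subset) auto
      then show ?thesis
        by (auto simp: top_unique)
    qed
    have "measure lborel ?U = (\<Sum>w\<in>?N. measure lborel (circle_arc (L x w) (m \<alpha> x w)))"
      using L finite_arc by (intro measure_finite_Union) (auto simp: good_def)
    also have "\<dots> = (\<Sum>w\<in>?N. m \<alpha> x w)"
      by (intro sum.cong refl measure_circle_arc m_nonneg m_le_1)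
    finally have U: "measure lborel ?U = (\<Sum>w\<in>?N. m \<alpha> x w)" .
    have "measure M (X \<alpha> -` {x} \<inter> space M) = measure lborel ({0..<1} - ?U)"
      unfolding fiber unfolding M_def by (rule measure_restrict_space) auto
    also have "\<dots> = measure lborel {0..<1::real} - measure lborel ?U"
      by (intro measure_Diff UN_least circle_arc_subset sets.finite_UN) (auto simp: circle_arc_borel)
    finally show ?thesis
      using U m_sum[of \<alpha> x] by simp
  qed
  have "distr M (count_space UNIV) (X \<alpha>) = measure_pmf (P \<alpha>)" for \<alpha>
  proof (rule measure_eqI_countable[of _ UNIV])
    show "emeasure (distr M (count_space UNIV) (X \<alpha>)) {x} = emeasure (measure_pmf (P \<alpha>)) {x}" for x
      using X_meas fiber_measure[of \<alpha> x]
      by (simp add: emeasure_distr M.emeasure_eq_measure emeasure_pmf_single)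
  qed (auto intro: countable_finite)
  moreover have "X \<alpha> u \<le> X \<beta> u" if "\<alpha> < \<beta>" "u \<in> space M" for \<alpha> \<beta> u
  proof -
    have u: "u \<in> {0..<1}"
      using that space_M by simp
    let ?x = "X \<alpha> u" and ?y = "X \<beta> u"
    have away_iff: "out \<gamma> u v w \<longleftrightarrow> X \<gamma> u \<in> branch v w" if "hasse_adj v w" for \<gamma> v w
      by (rule out_sink_iff[OF orient[OF u] sink_X[OF u] that])
    \<comment> \<open>An edge crossed on the way from \<open>?x\<close> to \<open>?y\<close> goes
      up: on a downward edge the arc shrinks from \<alpha> to \<beta>, so \<open>?x\<close> would
      already lie beyond the edge.\<close>
    have up: "v < w" if adj: "hasse_adj v w" and y: "?y \<in> branch v w" and x: "?x \<notin> branch v w" for v w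
      using adj
    proof (cases rule: hasse_adj_cases)
      case 2
      have "m \<beta> v w \<le> m \<alpha> v w"
        using m_up[OF \<open>\<alpha> < \<beta>\<close> 2(1)] m_flip[OF adj] by simp
      then have "circle_arc (L v w) (m \<beta> v w) \<subseteq> circle_arc (L v w) (m \<alpha> v w)"
        by (rule circle_arc_mono)
      moreover have "out \<beta> u v w"
        using away_iff adj y by blast
      ultimately have "out \<alpha> u v w"
        by (auto simp: out_def)
      then show ?thesis
        using away_iff adj x by blast
    qed
    \<comment> \<open>Every edge of the tree path from \<open>?x\<close> to \<open>?y\<close>
      separates the two. The next edge towards \<open>?y\<close> has a smaller branch, which still
      misses \<open>?x\<close>.\<close>
    have "v \<le> ?y" if "hasse_adj v w" "?y \<in> branch v w" "?x \<notin> branch v w" for v w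
      using that
    proof (induction "card (branch v w)" arbitrary: v w rule: less_induct)
      case less
      have "v < w"
        using less.prems by (rule up)
      moreover have "w \<le> ?y"
      proof (cases "?y = w")
        case False
        then obtain w' where w': "hasse_adj w w'" "?y \<in> branch w w'"
          using branch_cover by blast
        have "?y \<notin> branch w v"
          using branch_compl less.prems by blast
        then have "w' \<noteq> v"
          using w' by blast
        then show ?thesis
          using less.hyps[OF branch_card_less w'] branch_psubset less.prems w' by blast
      qed simp
      ultimately show ?case
        by simp
    qed
    then show ?thesis
      using branch_cover[of ?y ?x] notin_branch[of ?x] by (cases "?y = ?x") auto
  qed
  ultimately have "monotone_realization P M X"
    using M.prob_space_axioms X_meas by (auto simp: monotone_realization_def)
  then show ?thesis
    by (rule realizably_monotoneI)
qed

section \<open>The converse implication and the sufficient conditions\<close>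

lemma realizably_imp_stochastically_monotone:
  assumes "realizably_monotone P"
  shows "stochastically_monotone P"
proof -
  obtain M :: "('a \<Rightarrow> 'b) measure" and X where "monotone_realization P M X"
    using assms unfolding realizably_monotone_def by blast
  then have M: "prob_space M" and X: "\<And>\<gamma>. X \<gamma> \<in> M \<rightarrow>\<^sub>M count_space UNIV"
    and dist: "\<And>\<gamma>. distr M (count_space UNIV) (X \<gamma>) = measure_pmf (P \<gamma>)"
    and le: "\<And>\<alpha> \<beta> \<omega>. \<alpha> < \<beta> \<Longrightarrow> \<omega> \<in> space M \<Longrightarrow> X \<alpha> \<omega> \<le> X \<beta> \<omega>"
    by (auto simp: monotone_realization_def)
  interpret prob_space M
    by fact
  have prob: "measure_pmf.prob (P \<gamma>) U = prob (X \<gamma> -` U \<inter> space M)" for \<gamma> U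
    unfolding dist[symmetric] by (rule measure_distr[OF X]) simp
  have "prob (X \<alpha> -` U \<inter> space M) \<le> prob (X \<beta> -` U \<inter> space M)" if "\<alpha> < \<beta>" "up_set U" for \<alpha> \<beta> U
    using that le[OF that(1)] measurable_sets[OF X, of U \<beta>]
    by (intro finite_measure_mono) (auto simp: up_set_def)
  then show ?thesis
    by (simp add: stochastically_monotone_def stochastically_le_def prob)
qed

text \<open>This is the common form of the four conditions. For each kind of vertex of degree at
  least 3, all neighbours above or all below, either \<A> has the extremum at which its branches are
  most probable, or such vertices are excluded.\<close>

lemma monotonicity_equivalence_if_extremal:
  assumes W: "class_W TYPE('s::{finite, order})"
    and up: "(\<exists>b :: 'a::{finite, order}. \<forall>x. x \<le> b) \<or> \<not> (\<exists>T :: 's set. W_upper_star_poset T)"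
    and down: "(\<exists>a :: 'a. \<forall>x. a \<le> x) \<or> \<not> (\<exists>T :: 's set. W_lower_star_poset T)"
  shows "monotonicity_equivalence TYPE('a) TYPE('s)"
  unfolding monotonicity_equivalence_def
proof (intro allI iffI)
  fix P :: "'a \<Rightarrow> 's pmf"
  assume mono: "stochastically_monotone P"
  have tree: "finite_tree (hasse_adj :: 's \<Rightarrow> 's \<Rightarrow> bool)"
    using W by (intro hasse_finite_tree) (simp add: class_W_def)
  have le: "measure_pmf.prob (P \<alpha>) U \<le> measure_pmf.prob (P \<beta>) U" if "\<alpha> \<le> \<beta>" "up_set U" for \<alpha> \<beta> U
    using mono that unfolding stochastically_monotone_def stochastically_le_def
    by (cases "\<alpha> = \<beta>") (auto simp: less_le)
  show "realizably_monotone P"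
  proof (rule realization_exists[OF tree mono])
    fix v :: 's assume deg: "\<not> card {w. hasse_adj v w} \<le> 2"
    let ?B = "finite_tree.branch hasse_adj v"
    have "\<And>T :: 's set. \<not> Y_poset T"
      using W by (simp add: class_W_def)
    from no_Y_poset_branching[OF this deg]
    show "\<exists>p. \<forall>\<alpha> w. hasse_adj v w \<longrightarrow> measure_pmf.prob (P \<alpha>) (?B w) \<le> measure_pmf.prob p (?B w)"
    proof
      assume min: "\<forall>w. hasse_adj v w \<longrightarrow> covered_by UNIV v w"
      \<comment> \<open>Absence of \<open>W_upper_star_poset\<close> would contradict
        \<open>deg\<close>, so \<open>up\<close> yields a maximum. The branches at \<open>v\<close>
        are up-sets, hence most probable there.\<close>
      then obtain b :: 'a where "\<forall>x. x \<le> b"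
        using up no_W_upper_star_degree[of v] deg by blast
      then have "\<forall>\<alpha> w. hasse_adj v w \<longrightarrow> measure_pmf.prob (P \<alpha>) (?B w) \<le> measure_pmf.prob (P b) (?B w)"
        using min up_set_branch[OF tree] le by blast
      then show ?thesis ..
    next
      assume max: "\<forall>w. hasse_adj v w \<longrightarrow> covered_by UNIV w v"
      then obtain a :: 'a where a: "\<forall>x. a \<le> x"
        using down no_W_lower_star_degree[of v] deg by blast
      \<comment> \<open>Now the branches are complements of up-sets, so the minimum \<open>a\<close>
        gives them the largest probability.\<close>
      have "measure_pmf.prob (P \<alpha>) (?B w) \<le> measure_pmf.prob (P a) (?B w)" if adj: "hasse_adj v w" for \<alpha> w
      proof -
        have compl: "?B w = UNIV - finite_tree.branch hasse_adj w v"
          using finite_tree.branch_compl[OF tree finite_tree.adj_sym[OF tree adj]]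
          by (simp add: Compl_eq_Diff_UNIV)
        have "up_set (finite_tree.branch hasse_adj w v)"
          using max adj up_set_branch[OF tree] by blast
        then show ?thesis
          unfolding compl using le[of a \<alpha>] a
          by (simp add: measure_pmf.prob_compl[where A = "finite_tree.branch hasse_adj w v", simplified])
      qed
      then show ?thesis
        by blast
    qed
  qed
qed (rule realizably_imp_stochastically_monotone)

theorem theorem2p1:
  assumes "graph_connected (hasse_diagram (UNIV :: 'a::{finite, order} set))"
    and "graph_connected (hasse_diagram (UNIV :: 's::{finite, order} set))"
    and "class_W TYPE('s)"
  shows "((\<exists>a :: 'a. \<forall>x. a \<le> x) \<and> (\<exists>b :: 'a. \<forall>x. x \<le> b)
            \<longrightarrow> monotonicity_equivalence TYPE('a) TYPE('s)) \<and>
         ((\<exists>a :: 'a. \<forall>x. a \<le> x) \<and> class_W_lower_star TYPE('s)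
            \<longrightarrow> monotonicity_equivalence TYPE('a) TYPE('s)) \<and>
         ((\<exists>b :: 'a. \<forall>x. x \<le> b) \<and> class_W_upper_star TYPE('s)
            \<longrightarrow> monotonicity_equivalence TYPE('a) TYPE('s)) \<and>
         (up_down_poset TYPE('s)
            \<longrightarrow> monotonicity_equivalence TYPE('a) TYPE('s))"
proof (intro conjI impI)
  show "monotonicity_equivalence TYPE('a) TYPE('s)"
    if "(\<exists>a :: 'a. \<forall>x. a \<le> x) \<and> (\<exists>b :: 'a. \<forall>x. x \<le> b)"
    by (rule monotonicity_equivalence_if_extremal[OF assms(3)]) (use that in blast)+
  \<comment> \<open>The minimum of \<A> settles \<open>down\<close>, and the class of \<S> settles
    \<open>up\<close>; the next case is dual.\<close>
  show "monotonicity_equivalence TYPE('a) TYPE('s)"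
    if "(\<exists>a :: 'a. \<forall>x. a \<le> x) \<and> class_W_lower_star TYPE('s)"
    by (rule monotonicity_equivalence_if_extremal[OF assms(3)])
      (use that in \<open>simp_all add: class_W_lower_star_def\<close>)
  show "monotonicity_equivalence TYPE('a) TYPE('s)"
    if "(\<exists>b :: 'a. \<forall>x. x \<le> b) \<and> class_W_upper_star TYPE('s)"
    by (rule monotonicity_equivalence_if_extremal[OF assms(3)])
      (use that in \<open>simp_all add: class_W_upper_star_def\<close>)
  show "monotonicity_equivalence TYPE('a) TYPE('s)" if "up_down_poset TYPE('s)"
    by (rule monotonicity_equivalence_if_extremal[OF assms(3)])
      (use that in \<open>simp_all add: up_down_poset_def\<close>)
qed

end
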